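(* Let $u$ be a pattern with exactly one occurrence of the symbol $?$, with $|u|=k\geq 4$ and with all letters of $u$ distinct. Let $w=T(u)$ be the Toeplitz word determined by $u$, and let $G_n=G_n(w)$. Let $n=ak+b\geq 1$ with $0\leq b\leq k-1$. Then $$G_n=\begin{cases}G_{a+1}^{\,b}\times G_a^{\,k-b}, & b\neq 0,\\ G_a^{\,k}\rtimes \mathbb{Z}/k\mathbb{Z}, & b=0,\end{cases}$$ where the groups on the right-hand side are identified with subgroups of $S_n$ as follows. For $1\leq i\leq k$ let $A_i=\{j\in\{1,\dots,n\}: j\equiv i \pmod k\}$, so that $|A_i|=a+1$ for $i\leq b$ and $|A_i|=a$ for $i>b$, and the $m$-th element of $A_i$ is $i+(m-1)k$. If $b\neq 0$, the group consists of all $g\in S_n$ for which there are $\pi_i\in G_{|A_i|}$ $(1\leq i\leq k)$ with $g(i+(m-1)k)=i+(\pi_i(m)-1)k$ for all $i$ and all $1\leq m\leq |A_i|$. If $b=0$, the group consists of all $g\in S_n$ for which there are $c\in\mathbb{Z}/k\mathbb{Z}$ and $\pi_i\in G_a$ $(1\leq i\leq k)$ with $g(i+(m-1)k)=i'+(\pi_i(m)-1)k$ for all $i$ and all $1\leq m\leq a$, where $i'\in\{1,\dots,k\}$ is determined by $i'\equiv i+c\pmod k$.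
   Context: Toeplitz words: let $?$ be a symbol not in the finite alphabet $\Sigma$. For a pattern $u\in\Sigma(\Sigma\cup\{?\})^*$ let $T_0(u)=?^\omega$ and $T_{i+1}(u)=F_u(T_i(u))$, where $F_u(x)$, for $x\in(\Sigma\cup\{?\})^\omega$, is the word obtained from $u^\omega=uuu\cdots$ by replacing the sequence of all occurrences of $?$ by $x$. The Toeplitz word determined by $u$ is $T(u)=\lim_{i\to\infty}T_i(u)\in\Sigma^\omega$. The length $|u|$ counts the symbol $?$. $F_n(w)$ denotes the set of factors of length $n$ of $w$. A permutation $g\in S_n$ acts on a word $v=v_1\cdots v_n$ by $g(v)=v_{g^{-1}(1)}\cdots v_{g^{-1}(n)}$; the symmetry group of order $n$ of $w$ is $G_n(w)=\{\pi\in S_n \mid \pi(x)\in F_n(w)\text{ for each }x\in F_n(w)\}$; $G_0$ is the trivial group. *)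

theory Defs
  imports "HOL-Combinatorics.Permutations" "HOL-Number_Theory.Cong"
begin

text \<open>
  Infinite words over \<open>'a\<close> are functions \<open>nat \<Rightarrow> 'a\<close>, indexed from 0. Words that may
  contain the extra symbol \<open>?\<close> use the letter type \<open>'a option\<close>, where \<open>None\<close> stands for \<open>?\<close>.
\<close>

definition toeplitz_pattern :: "'a set \<Rightarrow> 'a option list \<Rightarrow> bool" where
  "toeplitz_pattern \<Sigma> u \<longleftrightarrow>
     u \<noteq> [] \<and> hd u \<in> Some ` \<Sigma> \<and> set u \<subseteq> Some ` \<Sigma> \<union> {None}"

definition omega_power :: "'b list \<Rightarrow> nat \<Rightarrow> 'b" where
  "omega_power u i = u ! (i mod length u)"

text \<open>
  An occurrence of \<open>?\<close> in \<open>uuu\<cdots>\<close> at position \<open>i\<close> is replaced by the letter of \<open>x\<close> whose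
  index is the number of earlier occurrences of \<open>?\<close>.
\<close>

definition toeplitz_fill :: "'a option list \<Rightarrow> (nat \<Rightarrow> 'a option) \<Rightarrow> nat \<Rightarrow> 'a option" where
  "toeplitz_fill u x i =
     (if omega_power u i = None then x (card {j. j < i \<and> omega_power u j = None})
      else omega_power u i)"

primrec toeplitz_approx :: "'a option list \<Rightarrow> nat \<Rightarrow> nat \<Rightarrow> 'a option" where
  "toeplitz_approx u 0 = (\<lambda>_. None)"
| "toeplitz_approx u (Suc i) = toeplitz_fill u (toeplitz_approx u i)"

text \<open>
  The limit is taken letterwise (the product topology of the discrete topologies): each
  letter of the approximations is eventually constant. For patterns it exists, is unique and
  lies over \<open>\<Sigma>\<close>, as shown below.
\<close>

definition toeplitz_word :: "'a option list \<Rightarrow> nat \<Rightarrow> 'a" where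
  "toeplitz_word u = (THE w. \<forall>n. \<forall>\<^sub>F i in sequentially. toeplitz_approx u i n = Some (w n))"

lemma toeplitz_approx_defined:
  assumes "toeplitz_pattern \<Sigma> u"
  shows "\<exists>c\<in>\<Sigma>. \<forall>i>n. toeplitz_approx u i n = Some c"
proof (induction n rule: less_induct)
  case (less n)
  have u: "u \<noteq> []" "hd u \<in> Some ` \<Sigma>" "set u \<subseteq> Some ` \<Sigma> \<union> {None}"
    using assms by (auto simp: toeplitz_pattern_def)
  show ?case
  proof (cases "omega_power u n")
    case None
    define h where "h = card {j. j < n \<and> omega_power u j = None}"
    have ne: "omega_power u 0 \<noteq> None"
      using u by (auto simp: omega_power_def hd_conv_nth)
    have "n \<noteq> 0"
    proof
      assume "n = 0"
      then show False using None ne by simp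
    qed
    have "{j. j < n \<and> omega_power u j = None} \<subseteq> {..<n} - {0}"
      using ne by (intro subsetI) (metis (mono_tags, lifting) Diff_iff lessThan_iff mem_Collect_eq singletonD)
    then have "h \<le> card ({..<n} - {0})"
      unfolding h_def by (intro card_mono) simp_all
    then have "h < n"
      using \<open>n \<noteq> 0\<close> by simp
    then obtain c where c: "c \<in> \<Sigma>" "\<forall>i>h. toeplitz_approx u i h = Some c"
      using less by blast
    have "toeplitz_approx u i n = Some c" if i: "i > n" for i
    proof -
      obtain i' where i': "i = Suc i'" "h < i'"
        using i \<open>h < n\<close> by (cases i) auto
      then have "toeplitz_approx u i n = toeplitz_approx u i' h"
        by (simp add: toeplitz_fill_def None h_def)
      then show ?thesis
        using c(2) i'(2) by simp
    qed
    then show ?thesis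
      using c(1) by blast
  next
    case (Some c)
    have "omega_power u n \<in> set u"
      using u(1) by (simp add: omega_power_def)
    then have "c \<in> \<Sigma>"
      using Some u(3) by auto
    moreover have "toeplitz_approx u i n = Some c" if "i > n" for i
      using that by (cases i) (simp_all add: toeplitz_fill_def Some)
    ultimately show ?thesis
      by blast
  qed
qed

lemma toeplitz_word_limit:
  assumes "toeplitz_pattern \<Sigma> u"
  shows "\<exists>!w. \<forall>n. \<forall>\<^sub>F i in sequentially. toeplitz_approx u i n = Some (w n)"
    and "\<forall>n. \<forall>\<^sub>F i in sequentially. toeplitz_approx u i n = Some (toeplitz_word u n)"
    and "range (toeplitz_word u) \<subseteq> \<Sigma>"
proof -
  let ?lim = "\<lambda>w. \<forall>n. \<forall>\<^sub>F i in sequentially. toeplitz_approx u i n = Some (w n)"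
  obtain w where w: "\<And>n. w n \<in> \<Sigma>" "\<And>n i. i > n \<Longrightarrow> toeplitz_approx u i n = Some (w n)"
  proof -
    have "\<forall>n. \<exists>c. c \<in> \<Sigma> \<and> (\<forall>i>n. toeplitz_approx u i n = Some c)"
      using toeplitz_approx_defined[OF assms] by blast
    then obtain w where "\<forall>n. w n \<in> \<Sigma> \<and> (\<forall>i>n. toeplitz_approx u i n = Some (w n))"
      by (rule choice[THEN exE])
    then show thesis
      using that by blast
  qed
  have lim: "?lim w"
  proof
    fix n
    show "\<forall>\<^sub>F i in sequentially. toeplitz_approx u i n = Some (w n)"
      by (rule eventually_mono[OF eventually_gt_at_top[of n]]) (rule w(2))
  qed
  have uniq: "v = w" if "?lim v" for v
  proof
    fix n
    have "\<forall>\<^sub>F i in sequentially. toeplitz_approx u i n = Some (v n) \<and>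
                               toeplitz_approx u i n = Some (w n)"
      using that lim by (simp add: eventually_conj)
    then obtain i where "toeplitz_approx u i n = Some (v n)" "toeplitz_approx u i n = Some (w n)"
      using eventually_happens'[OF sequentially_bot] by blast
    then show "v n = w n"
      by simp
  qed
  show "\<exists>!w. ?lim w"
    using lim uniq by blast
  have "toeplitz_word u = w"
    unfolding toeplitz_word_def using lim uniq by (rule the_equality)
  then show "?lim (toeplitz_word u)" "range (toeplitz_word u) \<subseteq> \<Sigma>"
    using lim w(1) by auto
qed

definition factors :: "nat \<Rightarrow> (nat \<Rightarrow> 'a) \<Rightarrow> 'a list set" where
  "factors n w = {map w [i..<i + n] | i. True}"

text \<open>
  Elements of \<open>S\<^sub>n\<close> are functions \<open>g\<close> with \<open>g permutes {1..n}\<close>, so the \<open>j\<close>-th letter of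
  \<open>v\<close> is \<open>v ! (j - 1)\<close>.
\<close>

definition perm_word :: "(nat \<Rightarrow> nat) \<Rightarrow> 'a list \<Rightarrow> 'a list" where
  "perm_word g v = map (\<lambda>j. v ! (inv g j - 1)) [1..<length v + 1]"

text \<open>For \<open>n = 0\<close> this is the trivial group \<open>{id}\<close>.\<close>

definition symmetry_group :: "(nat \<Rightarrow> 'a) \<Rightarrow> nat \<Rightarrow> (nat \<Rightarrow> nat) set" where
  "symmetry_group w n = {g. g permutes {1..n} \<and> (\<forall>x\<in>factors n w. perm_word g x \<in> factors n w)}"

lemma symmetry_group_0: "symmetry_group w 0 = {id}"
  by (auto simp: symmetry_group_def factors_def perm_word_def permutes_empty)

definition residue_block :: "nat \<Rightarrow> nat \<Rightarrow> nat \<Rightarrow> nat set" where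
  "residue_block k n i = {j \<in> {1..n}. [j = i] (mod k)}"

text \<open>
  In both definitions \<open>H m\<close> is a set of permutations of \<open>{1..m}\<close>. The first one realises the
  direct product of the groups \<open>H |A\<^sub>i|\<close>, where \<open>A\<^sub>i = residue_block k n i\<close>, as a
  subgroup of \<open>S\<^sub>n\<close>: the \<open>i\<close>-th factor permutes the elements \<open>i + (m - 1) * k\<close> of \<open>A\<^sub>i\<close>
  as it does their ranks \<open>m\<close>. The second one realises the semidirect product of the \<open>k\<close>-th
  power of \<open>H a\<close> and \<open>\<int>/k\<int>\<close> as a subgroup of \<open>S\<^sub>n\<close> for \<open>n = a * k\<close>, where \<open>\<int>/k\<int>\<close>
  shifts the blocks cyclically.
\<close>

definition block_product ::
    "nat \<Rightarrow> nat \<Rightarrow> (nat \<Rightarrow> (nat \<Rightarrow> nat) set) \<Rightarrow> (nat \<Rightarrow> nat) set" where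
  "block_product k n H =
     {g. g permutes {1..n} \<and>
         (\<exists>\<pi>. (\<forall>i\<in>{1..k}. \<pi> i \<in> H (card (residue_block k n i))) \<and>
              (\<forall>i\<in>{1..k}. \<forall>m\<in>{1..card (residue_block k n i)}.
                 g (i + (m - 1) * k) = i + (\<pi> i m - 1) * k))}"

definition block_semidirect ::
    "nat \<Rightarrow> nat \<Rightarrow> (nat \<Rightarrow> (nat \<Rightarrow> nat) set) \<Rightarrow> (nat \<Rightarrow> nat) set" where
  "block_semidirect k a H =
     {g. g permutes {1..a * k} \<and>
         (\<exists>c\<in>{0..<k}. \<exists>\<pi>. (\<forall>i\<in>{1..k}. \<pi> i \<in> H a) \<and>
              (\<forall>i\<in>{1..k}. \<forall>i'\<in>{1..k}. [i' = i + c] (mod k) \<longrightarrow>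
                 (\<forall>m\<in>{1..a}. g (i + (m - 1) * k) = i' + (\<pi> i m - 1) * k)))}"

lemma residue_block_eq:
  assumes "n = a * k + b" "b < k" "1 \<le> i" "i \<le> k"
  shows "residue_block k n i = (\<lambda>m. i + (m - 1) * k) ` {1..(if i \<le> b then a + 1 else a)}"
    (is "_ = ?f ` {1..?s}")
proof (intro equalityI subsetI)
  fix j assume "j \<in> residue_block k n i"
  then have j: "1 \<le> j" "j \<le> n" "[j = i] (mod k)"
    by (auto simp: residue_block_def)
  have "i \<le> j"
  proof (rule ccontr)
    assume "\<not> i \<le> j"
    then have "j < k" using assms by simp
    then have "i mod k = j" using j(3) by (simp add: cong_def)
    then show False using \<open>\<not> i \<le> j\<close> j(1) assms by (cases "i = k") auto
  qed
  then have "k dvd j - i"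
    using j(3) by (metis cong_altdef_nat cong_sym)
  then obtain q where "j - i = k * q" ..
  then have q: "j = i + q * k"
    using \<open>i \<le> j\<close> by (simp add: mult.commute)
  have "q < ?s"
  proof (rule ccontr)
    assume "\<not> q < ?s"
    then have "?s * k \<le> q * k" by simp
    then have "i + ?s * k \<le> a * k + b" using j(2) q assms(1) by linarith
    then show False using assms by (auto split: if_splits)
  qed
  then show "j \<in> ?f ` {1..?s}"
    using q by (intro image_eqI[of _ _ "q + 1"]) auto
next
  fix j assume "j \<in> ?f ` {1..?s}"
  then obtain m where m: "1 \<le> m" "m \<le> ?s" "j = i + (m - 1) * k"
    by auto
  have "m - 1 \<le> ?s - 1" using m by simp
  then have "(m - 1) * k \<le> (?s - 1) * k" by simp
  moreover have "i + (?s - 1) * k \<le> n"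
  proof (cases "i \<le> b")
    case False
    then have "1 \<le> a" using m by auto
    then obtain a' where "a = Suc a'" by (cases a) auto
    then show ?thesis using False assms by simp
  qed (use assms in simp)
  ultimately have "j \<le> n"
    using m(3) by linarith
  moreover have "1 \<le> j" "[j = i] (mod k)"
    using m(3) assms(3) by (simp_all add: cong_def)
  ultimately show "j \<in> residue_block k n i"
    by (simp add: residue_block_def)
qed

lemma card_residue_block:
  assumes "n = a * k + b" "b < k" "1 \<le> i" "i \<le> k"
  shows "card (residue_block k n i) = (if i \<le> b then a + 1 else a)"
proof -
  have "inj_on (\<lambda>m. i + (m - 1) * k) {1..(if i \<le> b then a + 1 else a)}"
    using assms(2) by (intro inj_onI) auto
  then show ?thesis
    unfolding residue_block_eq[OF assms] by (subst card_image) auto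
qed

end

theory Submission
  imports Defs "HOL-Combinatorics.Cycles"
begin

text \<open>
  The word is recurrent, so for positions \<open>j\<close>, \<open>j'\<close> the set of pairs of letters which factors
  carry there depends only on \<open>j' - j\<close>, and a symmetry \<open>g\<close> preserves this set. As there are at
  least three letters, the set determines \<open>j' - j\<close> modulo \<open>k\<close>; hence \<open>g\<close> shifts all residues by a
  constant, which is 0 if the blocks have unequal sizes. Filling a factor into the hole positions of
  one block shows that \<open>g\<close> acts on every block by a symmetry of the smaller order.
\<close>

lemma dvd_abs_less_imp_zero:
  fixes d x :: int
  shows "d dvd x \<Longrightarrow> \<bar>x\<bar> < d \<Longrightarrow> x = 0"
  using dvd_imp_le_int[of x d] by force

section \<open>Self-similar words with one hole per period\<close>

text \<open>All that the group computation uses of \<open>T(u)\<close>: the letters at the holes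
  (residue \<open>p\<close>) spell the word again, and every other residue has a constant letter of
  its own. A letter at a hole may coincide with any of these. \<open>0 < p\<close> reflects that a
  pattern begins with a letter.\<close>

locale one_hole_word =
  fixes w :: "nat \<Rightarrow> 'a" and k p :: nat
  assumes k: "4 \<le> k"
    and p: "0 < p" "p < k"
    and hole: "w (p + k * j) = w j"
    and eq_iff: "\<lbrakk>i mod k \<noteq> p; j mod k \<noteq> p\<rbrakk> \<Longrightarrow> w i = w j \<longleftrightarrow> i mod k = j mod k"
begin

text \<open>If \<open>j\<close> is the hole \<open>p + k * q\<close>, its letter is that of position
  \<open>q\<close>, and the shift loses one factor \<open>k\<close>. As \<open>p > 0\<close>,
  \<open>q\<close> is smaller than \<open>j\<close>, so fewer than \<open>l\<close> such descents
  reach a position outside the holes, where only the residue matters.\<close>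

lemma shift_power: "j < l \<Longrightarrow> w (j + c * k ^ l) = w j"
proof (induction l arbitrary: j)
  case (Suc l)
  show ?case
  proof (cases "j mod k = p")
    case True
    define q where "q = j div k"
    have j: "j = p + k * q"
      using True unfolding q_def by (metis mod_mult_div_eq)
    have "q \<le> k * q" using k by simp
    then have "q < l" using Suc.prems p(1) j by linarith
    have "j + c * k ^ Suc l = p + k * (q + c * k ^ l)"
      by (simp add: j algebra_simps)
    then show ?thesis
      using hole Suc.IH[OF \<open>q < l\<close>] j by metis
  next
    case False
    moreover have "(j + c * k ^ Suc l) mod k = (j + c * k ^ l * k) mod k"
      by (simp add: ac_simps)
    then have "(j + c * k ^ Suc l) mod k = j mod k" by simp
    ultimately show ?thesis
      by (subst eq_iff) simp_all
  qed
qed simp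

text \<open>The occurrence is at a positive position, which leaves room for the subtraction in
  \<open>window_with_hole\<close>.\<close>

lemma recurrent: "\<exists>s>0. \<forall>j<l. w (s + j) = w (t + j)"
proof (intro exI[of _ "t + 1 * k ^ (t + l)"] conjI allI impI)
  show "0 < t + 1 * k ^ (t + l)"
    using k by simp
  show "w (t + 1 * k ^ (t + l) + j) = w (t + j)" if "j < l" for j
    using shift_power[of "t + j" "t + l" 1] that by (simp add: ac_simps)
qed

text \<open>Spreads an arbitrary factor over one residue block: start the window so that its
  \<open>i\<close>-th position is the hole \<open>p + k * r\<close>, where \<open>r\<close> is an
  occurrence of the factor. \<open>r > 0\<close> keeps the natural subtraction exact.\<close>

lemma window_with_hole:
  assumes "i \<in> {1..k}"
  shows "\<exists>s. [s + (i - 1) = p] (mod k) \<and> (\<forall>j<l. w (s + (i - 1) + j * k) = w (t + j))"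
proof -
  obtain r where r: "r > 0" "\<forall>j<l. w (r + j) = w (t + j)"
    using recurrent by blast
  have "k * 1 \<le> k * r" using r(1) by (intro mult_le_mono) auto
  moreover have "i - 1 \<le> k" using assms by auto
  ultimately have eq: "p + k * r - (i - 1) + (i - 1) = p + k * r"
    by linarith
  show ?thesis
  proof (intro exI[of _ "p + k * r - (i - 1)"] conjI allI impI)
    show "[p + k * r - (i - 1) + (i - 1) = p] (mod k)"
      unfolding eq by (simp add: cong_def)
    fix j assume "j < l"
    have "p + k * r + j * k = p + k * (r + j)" by (simp add: algebra_simps)
    then show "w (p + k * r - (i - 1) + (i - 1) + j * k) = w (t + j)"
      unfolding eq using hole r(2) \<open>j < l\<close> by (simp only:)
  qed
qed

text \<open>Counterpart of \<open>window_with_hole\<close>: consecutive holes always spell a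
  factor.\<close>

lemma hole_value:
  assumes "[i = p] (mod k)"
  shows "\<exists>q. \<forall>j. w (i + j * k) = w (q + j)"
proof (intro exI allI)
  fix j
  have "i mod k = p" using assms p by (simp add: cong_def)
  then have "i + j * k = p + k * (i div k + j)"
    by (metis add.assoc distrib_left mod_mult_div_eq mult.commute)
  then show "w (i + j * k) = w (i div k + j)"
    using hole by simp
qed

section \<open>Residues and letters\<close>

text \<open>At most three of the \<open>k\<close> residues are forbidden, and
  \<open>4 \<le> k\<close>. The letter of the remaining residue serves below as a probe.\<close>

lemma avoid_two_residues:
  fixes x y :: int
  shows "\<exists>s. s mod k \<noteq> p \<and> \<not> [int s = x] (mod int k) \<and> \<not> [int s = y] (mod int k)"
proof -
  have "card {p, nat (x mod int k), nat (y mod int k)} < card {..<k}"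
    using k by (intro le_less_trans[OF card_insert_le_m1[of 3]]) (auto intro: card_insert_le_m1)
  then have "\<not> {..<k} \<subseteq> {p, nat (x mod int k), nat (y mod int k)}"
    by (metis card_mono finite.emptyI finite.insertI not_le)
  then obtain s where s: "s < k" "s \<noteq> p" "s \<noteq> nat (x mod int k)" "s \<noteq> nat (y mod int k)"
    by blast
  have "int s mod int k = int s" using s(1) by simp
  then show ?thesis
    using s by (intro exI[of _ s]) (auto simp: cong_def)
qed

lemma hole_residue: "i mod k = p \<longleftrightarrow> [int i = int p] (mod int k)"
  using p unfolding cong_int_iff by (simp add: cong_def)

lemma letter_cong:
  "\<lbrakk>i mod k \<noteq> p; j mod k \<noteq> p; w i = w j\<rbrakk> \<Longrightarrow> [int i = int j] (mod int k)"
  using eq_iff unfolding cong_int_iff by (simp add: cong_def)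

lemma ex_shift: "\<exists>t. [int (t + j) = x] (mod int k)"
proof -
  have "0 \<le> (x - int j) mod int k" using k by simp
  then have "int (nat ((x - int j) mod int k) + j) = (x - int j) mod int k + int j" by simp
  moreover have "[(x - int j) mod int k + int j = x] (mod int k)"
    by (simp add: cong_def mod_simps)
  ultimately show ?thesis by metis
qed

section \<open>Symmetries in terms of positions\<close>

text \<open>Membership in the symmetry group without inverses: the letter at \<open>j\<close>
  reappears at \<open>g j\<close>. The subtractions of 1 reconcile positions from 1 with a word
  indexed from 0.\<close>

definition word_sym :: "nat \<Rightarrow> (nat \<Rightarrow> nat) \<Rightarrow> bool" where
  "word_sym n g \<longleftrightarrow> g permutes {1..n} \<and>
     (\<forall>t. \<exists>s. \<forall>j\<in>{1..n}. w (t + (j - 1)) = w (s + (g j - 1)))"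

lemma perm_word_factor_iff:
  assumes g: "g permutes {1..n}"
  shows "perm_word g (map w [t..<t + n]) = map w [s..<s + n] \<longleftrightarrow>
    (\<forall>j\<in>{1..n}. w (t + (j - 1)) = w (s + (g j - 1)))" (is "?L \<longleftrightarrow> ?R")
proof -
  have inv: "inv g j \<in> {1..n}" if "j \<in> {1..n}" for j
    using permutes_in_image[OF permutes_inv[OF g]] that by blast
  have "?L \<longleftrightarrow> (\<forall>i<n. w (t + (inv g (Suc i) - 1)) = w (s + i))"
  proof -
    have "inv g (Suc i) - 1 < n" if "i < n" for i
      using inv[of "Suc i"] that by auto
    then show ?thesis
      by (auto simp: perm_word_def list_eq_iff_nth_eq nth_append simp del: upt_Suc)
  qed
  also have "\<dots> \<longleftrightarrow> (\<forall>j\<in>{1..n}. w (t + (inv g j - 1)) = w (s + (j - 1)))"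
  proof safe
    fix j assume "\<forall>i<n. w (t + (inv g (Suc i) - 1)) = w (s + i)" "j \<in> {1..n}"
    then show "w (t + (inv g j - 1)) = w (s + (j - 1))"
      by (cases j) auto
  qed auto
  \<comment> \<open>Substituting \<open>g j\<close> for \<open>j\<close> removes the
    inverse.\<close>
  also have "\<dots> \<longleftrightarrow> ?R"
    using inv permutes_in_image[OF g] permutes_inverses[OF g] by metis
  finally show ?thesis .
qed

lemma symmetry_group_iff: "g \<in> symmetry_group w n \<longleftrightarrow> word_sym n g"
proof -
  have "(\<forall>x\<in>factors n w. perm_word g x \<in> factors n w) \<longleftrightarrow>
    (\<forall>t. \<exists>s. perm_word g (map w [t..<t + n]) = map w [s..<s + n])"
    by (auto simp: factors_def)
  then show ?thesis
    using perm_word_factor_iff[of g n] by (auto simp: symmetry_group_def word_sym_def)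
qed

lemma word_sym_funpow:
  assumes "word_sym n g"
  shows "word_sym n (g ^^ m)"
proof (induction m)
  case 0
  have "word_sym n id"
    unfolding word_sym_def using permutes_id by auto
  then show ?case by (simp add: id_def)
next
  case (Suc m)
  have img: "(g ^^ m) j \<in> {1..n}" if "j \<in> {1..n}" for j
    using Suc that permutes_in_image unfolding word_sym_def by metis
  have "\<exists>s. \<forall>j\<in>{1..n}. w (t + (j - 1)) = w (s + ((g ^^ Suc m) j - 1))" for t
  proof -
    obtain s where s: "\<forall>j\<in>{1..n}. w (t + (j - 1)) = w (s + ((g ^^ m) j - 1))"
      using Suc unfolding word_sym_def by blast
    obtain s' where "\<forall>j\<in>{1..n}. w (s + (j - 1)) = w (s' + (g j - 1))"
      using assms unfolding word_sym_def by blast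
    then show ?thesis using s img by (intro exI[of _ s']) simp
  qed
  moreover have "(g ^^ Suc m) permutes {1..n}"
    using Suc assms permutes_compose[of "g ^^ m" _ g] unfolding word_sym_def by (metis funpow.simps(2))
  ultimately show ?case unfolding word_sym_def by blast
qed

text \<open>A symmetry only maps factors to factors; the inverse does so too because
  \<open>g\<close> has finite order, so its inverse is a power of \<open>g\<close>.\<close>

lemma word_sym_inv:
  assumes "word_sym n g"
  shows "word_sym n (inv g)"
proof -
  have g: "g permutes {1..n}" using assms by (simp add: word_sym_def)
  then have "permutation g" by (auto simp: permutation_permutes)
  then obtain m where m: "g ^^ m = id" "m > 0"
    using permutation_is_nilpotent by blast
  have "g \<circ> g ^^ (m - 1) = g ^^ Suc (m - 1)" by simp
  also have "\<dots> = id" using m by simp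
  finally have "g \<circ> g ^^ (m - 1) = id" .
  then have "inv g = g ^^ (m - 1)"
    by (metis comp_assoc comp_id id_comp permutes_inv_o(2)[OF g])
  then show ?thesis using word_sym_funpow[OF assms] by simp
qed

section \<open>Symmetries shift residues by a constant\<close>

text \<open>
  Two positions of equal residue can both carry any given one of the \<open>k - 1 \<ge> 3\<close> letters, while two
  positions of different residue can carry the same letter only for at most two letters.
\<close>

lemma word_sym_cong_0:
  assumes g: "word_sym n g" and j: "j \<in> {1..n}" "j' \<in> {1..n}" "[int j = int j'] (mod int k)"
  shows "[int (g j) = int (g j')] (mod int k)"
proof (rule ccontr)
  assume neq: "\<not> ?thesis"
  define e where "e = int (g j') - int (g j)"
  \<comment> \<open>If one of the image positions is a hole, the other has residue
    \<open>p + e\<close> or \<open>p - e\<close>. Excluding both leaves no place for the letter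
    \<open>w s\<close>.\<close>
  obtain s where s: "s mod k \<noteq> p" "\<not> [int s = int p + e] (mod int k)"
      "\<not> [int s = int p - e] (mod int k)"
    using avoid_two_residues by metis
  \<comment> \<open>This window puts the letter \<open>w s\<close> at both \<open>j\<close> and
    \<open>j'\<close>.\<close>
  obtain t where t: "[int (t + (j - 1)) = int s] (mod int k)"
    using ex_shift by blast
  have t': "[int (t + (j' - 1)) = int s] (mod int k)"
  proof -
    have "int (t + (j' - 1)) = int (t + (j - 1)) + (int j' - int j)"
      using j by (simp add: of_nat_diff)
    moreover have "[int (t + (j - 1)) + (int j' - int j) = int s + 0] (mod int k)"
      using j(3) t by (intro cong_add) (simp_all add: cong_diff_iff_cong_0 cong_sym)
    ultimately show ?thesis by (simp only: add_0_right)
  qed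
  have ws: "w (t + (j - 1)) = w s" "w (t + (j' - 1)) = w s"
    using t t' s(1) eq_iff by (metis cong_def cong_int_iff)+
  obtain r where r: "\<forall>j\<in>{1..n}. w (t + (j - 1)) = w (r + (g j - 1))"
    using g unfolding word_sym_def by blast
  define i where "i = r + (g j - 1)"
  define i' where "i' = r + (g j' - 1)"
  have "g j \<in> {1..n}" "g j' \<in> {1..n}"
    using g j permutes_in_image unfolding word_sym_def by metis+
  then have i': "int i' = int i + e"
    by (auto simp: i_def i'_def e_def of_nat_diff)
  have wi: "w i = w s" "w i' = w s"
    using r j ws unfolding i_def i'_def by simp_all
  have ne: "\<not> [int i = int i'] (mod int k)"
    using neq unfolding i' e_def by (auto simp: cong_iff_dvd_diff dvd_diff_commute)
  \<comment> \<open>Outside the holes equal letters force equal residues, so two different residues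
    require a hole.\<close>
  have "i mod k = p \<or> i' mod k = p"
    using ne wi letter_cong by metis
  then show False
  proof
    assume "i mod k = p"
    then have i: "[int i = int p] (mod int k)" by (simp add: hole_residue)
    then have "i' mod k \<noteq> p"
      using ne by (metis hole_residue cong_sym cong_trans)
    then have "[int s = int i'] (mod int k)" using letter_cong s(1) wi(2) by metis
    moreover have "[int i' = int p + e] (mod int k)"
      unfolding i' by (intro cong_add i cong_refl)
    ultimately show False using s(2) cong_trans by blast
  next
    assume "i' mod k = p"
    then have i: "[int i' = int p] (mod int k)" by (simp add: hole_residue)
    then have "i mod k \<noteq> p"
      using ne by (metis hole_residue cong_sym cong_trans)
    then have "[int s = int i] (mod int k)" using letter_cong s(1) wi(1) by metis
    moreover have "[int i' - e = int p - e] (mod int k)"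
      by (intro cong_diff i cong_refl)
    ultimately show False using s(3) cong_trans unfolding i' by auto
  qed
qed

text \<open>
  For \<open>j\<close>, \<open>j'\<close> of different residue, some letter at \<open>j'\<close> is compatible with all letters at
  \<open>j\<close> (those filled into the hole); every other letter at \<open>j'\<close> is compatible with two only. The
  exceptional letter determines the difference of the residues.
\<close>

lemma word_sym_cong_diff:
  assumes g: "word_sym n g" and j: "j \<in> {1..n}" "j' \<in> {1..n}"
  shows "[int (g j') - int (g j) = int j' - int j] (mod int k)"
proof (cases "[int j = int j'] (mod int k)")
  case True
  then have "[int (g j') - int (g j) = 0] (mod int k)" "[int j' - int j = 0] (mod int k)"
    using word_sym_cong_0[OF g j True] by (simp_all add: cong_diff_iff_cong_0 cong_sym)
  then show ?thesis by (metis cong_sym cong_trans)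
next
  case False
  have gp: "g permutes {1..n}" using g by (simp add: word_sym_def)
  have gj: "g j \<in> {1..n}" "g j' \<in> {1..n}"
    using j permutes_in_image[OF gp] by blast+
  \<comment> \<open>The preceding lemma for the inverse of \<open>g\<close>: different residues stay
    different.\<close>
  have neq: "\<not> [int (g j) = int (g j')] (mod int k)"
    using word_sym_cong_0[OF word_sym_inv[OF g] gj] False permutes_inverses[OF gp] by auto
  define e where "e = int j' - int j"
  define e' where "e' = int (g j') - int (g j)"
  show ?thesis
  proof (rule ccontr)
    assume "\<not> ?thesis"
    then have ee: "\<not> [e' = e] (mod int k)" by (simp add: e_def e'_def)
    \<comment> \<open>With \<open>w s\<close> filled into a hole at \<open>j\<close>, its image has
      residue \<open>p - e'\<close> if the image of \<open>j'\<close> is a hole, and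
      \<open>p + e - e'\<close> otherwise. Neither may be the residue of \<open>w s\<close>.\<close>
    obtain s where s: "s mod k \<noteq> p" "\<not> [int s = int p + e - e'] (mod int k)"
        "\<not> [int s = int p - e'] (mod int k)"
      using avoid_two_residues by metis
    obtain t where t: "[int (t + (j - 1)) = int p] (mod int k)" "w (t + (j - 1)) = w s"
    proof -
      \<comment> \<open>A late occurrence of the letter keeps the start
        \<open>p + k * r - (j - 1)\<close> of the window from truncating.\<close>
      have "\<exists>r\<ge>j. w r = w s"
        using shift_power[of s "Suc s" j] k
        by (intro exI[of _ "s + j * k ^ Suc s"]) (auto intro: trans_le_add2)
      then obtain r where r: "r \<ge> j" "w r = w s" by blast
      have "1 * r \<le> k * r" using k by (intro mult_le_mono) auto
      then have "j - 1 \<le> p + k * r" using r by linarith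
      then have "p + k * r - (j - 1) + (j - 1) = p + k * r" by simp
      then show thesis
        using that[of "p + k * r - (j - 1)"] r hole by (simp add: cong_def)
    qed
    obtain r where r: "\<forall>j\<in>{1..n}. w (t + (j - 1)) = w (r + (g j - 1))"
      using g unfolding word_sym_def by blast
    define h where "h = t + (j' - 1)"
    define i where "i = r + (g j - 1)"
    define i' where "i' = r + (g j' - 1)"
    have i': "int i' = int i + e'"
      using gj by (auto simp: i_def i'_def e'_def of_nat_diff)
    have wi: "w i = w s" "w i' = w h"
      using r j t(2) unfolding i_def i'_def h_def by simp_all
    have "int h = int (t + (j - 1)) + e"
      using j by (simp add: h_def e_def of_nat_diff)
    then have h: "[int h = int p + e] (mod int k)"
      using cong_add[OF t(1) cong_refl[of e]] by simp
    have hn: "h mod k \<noteq> p"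
    proof
      assume "h mod k = p"
      then have "[int p + e = int p + 0] (mod int k)"
        using h by (metis add_0_right hole_residue cong_sym cong_trans)
      then have "[e = 0] (mod int k)" by (simp only: cong_add_lcancel)
      then show False using False by (simp add: e_def cong_iff_dvd_diff dvd_diff_commute)
    qed
    show False
    proof (cases "i' mod k = p")
      case True
      then have "[int i' - e' = int p - e'] (mod int k)"
        by (intro cong_diff cong_refl) (simp add: hole_residue)
      then have i: "[int i = int p - e'] (mod int k)" by (simp add: i')
      have "i mod k \<noteq> p"
      proof
        assume "i mod k = p"
        then have "[int i' = int i] (mod int k)" using True by (metis hole_residue cong_sym cong_trans)
        then have "[e' = 0] (mod int k)" unfolding i' by (simp add: cong_iff_dvd_diff)
        then show False using neq by (simp add: e'_def cong_iff_dvd_diff dvd_diff_commute)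
      qed
      then show False using letter_cong[OF s(1)] wi(1) s(3) i cong_trans by metis
    next
      case False
      then have "[int i' = int p + e] (mod int k)"
        using letter_cong hn wi(2) h cong_trans by metis
      then have "[int i' - e' = int p + e - e'] (mod int k)"
        by (intro cong_diff cong_refl)
      then have i: "[int i = int p + e - e'] (mod int k)" by (simp add: i')
      have "i mod k \<noteq> p"
      proof
        assume "i mod k = p"
        then have "[int p + (e - e') = int p + 0] (mod int k)"
          using i by (metis add_0_right add_diff_eq hole_residue cong_sym cong_trans)
        then have "[e - e' = 0] (mod int k)" by (simp only: cong_add_lcancel)
        then show False using ee by (simp add: cong_iff_dvd_diff dvd_diff_commute)
      qed
      then show False using letter_cong[OF s(1)] wi(1) s(2) i cong_trans by metis
    qed
  qed
qed

text \<open>Comparing every position with position 1 gives the constant, the residue of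
  \<open>g 1 - 1\<close>.\<close>

lemma ex_word_sym_shift:
  assumes g: "word_sym n g" and "1 \<le> n"
  shows "\<exists>c<k. \<forall>j\<in>{1..n}. [g j = j + c] (mod k)"
proof -
  define c where "c = nat ((int (g 1) - 1) mod int k)"
  have c: "int c = (int (g 1) - 1) mod int k" using k by (simp add: c_def)
  have "c < k" using c k by (metis of_nat_less_iff pos_mod_bound of_nat_0_less_iff less_le_trans zero_less_numeral)
  moreover have "[g j = j + c] (mod k)" if "j \<in> {1..n}" for j
  proof -
    have "[int (g j) - int (g 1) + int (g 1) = int j - int 1 + int (g 1)] (mod int k)"
      using word_sym_cong_diff[OF g _ that, of 1] assms(2) by (intro cong_add cong_refl) auto
    then have "[int (g j) = int j + (int (g 1) - 1)] (mod int k)" by (simp add: algebra_simps)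
    moreover have "[int j + (int (g 1) - 1) = int j + int c] (mod int k)"
      unfolding c by (simp add: cong_def mod_simps)
    ultimately show ?thesis by (metis cong_int_iff cong_trans of_nat_add)
  qed
  ultimately show ?thesis by blast
qed

section \<open>Restriction to blocks and assembly from blocks\<close>

text \<open>Fill a given factor into the holes of block \<open>i\<close> and read the image along
  block \<open>i'\<close>. That block either lies on holes, where it spells a factor, or carries a
  single letter.\<close>

lemma word_sym_restrict:
  assumes g: "word_sym n g" and i: "i \<in> {1..k}" "i' \<in> {1..k}"
    and blocks: "residue_block k n i = (\<lambda>m. i + (m - 1) * k) ` {1..M}"
      "residue_block k n i' = (\<lambda>m. i' + (m - 1) * k) ` {1..M}"
    and img: "g ` residue_block k n i \<subseteq> residue_block k n i'"
  shows "\<exists>\<pi>. word_sym M \<pi> \<and> (\<forall>m\<in>{1..M}. g (i + (m - 1) * k) = i' + (\<pi> m - 1) * k)"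
proof -
  have gp: "g permutes {1..n}" using g by (simp add: word_sym_def)
  have "\<forall>m\<in>{1..M}. \<exists>m'\<in>{1..M}. g (i + (m - 1) * k) = i' + (m' - 1) * k"
    using img unfolding blocks by auto
  then obtain f where f: "\<forall>m\<in>{1..M}. f m \<in> {1..M} \<and> g (i + (m - 1) * k) = i' + (f m - 1) * k"
    by metis
  \<comment> \<open>The identity outside \<open>{1..M}\<close> is what \<open>permutes\<close>
    demands.\<close>
  define \<pi> where "\<pi> m = (if m \<in> {1..M} then f m else m)" for m
  have \<pi>: "\<pi> m \<in> {1..M}" "g (i + (m - 1) * k) = i' + (\<pi> m - 1) * k" if "m \<in> {1..M}" for m
    using f that by (simp_all add: \<pi>_def)
  have "inj_on \<pi> {1..M}"
  proof (rule inj_onI)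
    fix m m' assume m: "m \<in> {1..M}" "m' \<in> {1..M}" "\<pi> m = \<pi> m'"
    then have "g (i + (m - 1) * k) = g (i + (m' - 1) * k)" using \<pi>(2) by simp
    then have "(m - 1) * k = (m' - 1) * k"
      using permutes_inj[OF gp] by (simp add: inj_eq)
    then show "m = m'" using k m(1,2) by auto
  qed
  moreover have "\<pi> ` {1..M} \<subseteq> {1..M}" using \<pi>(1) by blast
  ultimately have "bij_betw \<pi> {1..M} {1..M}"
    by (simp add: bij_betw_def endo_inj_surj)
  then have perm: "\<pi> permutes {1..M}"
    by (rule bij_imp_permutes) (simp only: \<pi>_def if_False)
  have "\<exists>s. \<forall>m\<in>{1..M}. w (t + (m - 1)) = w (s + (\<pi> m - 1))" for t
  proof -
    obtain t' where t': "\<forall>m<M. w (t' + (i - 1) + m * k) = w (t + m)"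
      using window_with_hole[OF i(1)] by blast
    obtain s where s: "\<forall>j\<in>{1..n}. w (t' + (j - 1)) = w (s + (g j - 1))"
      using g unfolding word_sym_def by blast
    have eq: "w (t + (m - 1)) = w (s + (i' - 1) + (\<pi> m - 1) * k)" if m: "m \<in> {1..M}" for m
    proof -
      have "i + (m - 1) * k \<in> residue_block k n i" unfolding blocks using m by blast
      then have "i + (m - 1) * k \<in> {1..n}" by (simp add: residue_block_def)
      then have "w (t' + (i + (m - 1) * k - 1)) = w (s + (g (i + (m - 1) * k) - 1))"
        using s by blast
      moreover have "i + (m - 1) * k - 1 = (i - 1) + (m - 1) * k" using i by simp
      moreover have "i' + (\<pi> m - 1) * k - 1 = (i' - 1) + (\<pi> m - 1) * k" using i by simp
      moreover have "m - 1 < M" using m by auto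
      ultimately show ?thesis using t' \<pi>(2)[OF m] by (simp add: add.assoc)
    qed
    show ?thesis
    proof (cases "(s + (i' - 1)) mod k = p")
      case True
      then obtain q where "\<forall>m. w (s + (i' - 1) + m * k) = w (q + m)"
        using hole_value p by (metis cong_def mod_less)
      then show ?thesis using eq by auto
    next
      case False
      \<comment> \<open>The image is constant here, hence so is the given factor, and any
        permutation fixes it: the start \<open>t\<close> itself is the witness.\<close>
      then have "w (s + (i' - 1) + m * k) = w (s + (i' - 1))" for m
        by (subst eq_iff) simp_all
      then show ?thesis using eq \<pi>(1) by (intro exI[of _ t]) simp
    qed
  qed
  then show ?thesis using perm \<pi>(2) unfolding word_sym_def by blast
qed

text \<open>In each window exactly one residue class \<open>i\<close> lies on holes. Its filled-in
  factor is permuted by \<open>\<pi> i\<close> and put on the holes of a window in which class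
  \<open>\<sigma> i\<close> is the hole class. The other classes then match because all residues are
  shifted by the same \<open>c\<close>.\<close>

lemma word_sym_assemble:
  assumes gp: "g permutes {1..n}"
    and blocks: "\<And>i. i \<in> {1..k} \<Longrightarrow> residue_block k n i = (\<lambda>m. i + (m - 1) * k) ` {1..M i}"
    and \<sigma>: "\<And>i. i \<in> {1..k} \<Longrightarrow> \<sigma> i \<in> {1..k} \<and> [\<sigma> i = i + c] (mod k)"
    and \<pi>: "\<And>i. i \<in> {1..k} \<Longrightarrow> word_sym (M i) (\<pi> i)"
    and g: "\<And>i m. \<lbrakk>i \<in> {1..k}; m \<in> {1..M i}\<rbrakk> \<Longrightarrow>
      g (i + (m - 1) * k) = \<sigma> i + (\<pi> i m - 1) * k"
  shows "word_sym n g"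
proof -
  have "\<exists>s. \<forall>j\<in>{1..n}. w (t + (j - 1)) = w (s + (g j - 1))" for t
  proof -
    obtain r where r: "r < k" "[t + r = p] (mod k)"
    proof -
      obtain r' where "[int (r' + t) = int p] (mod int k)" using ex_shift by blast
      then have "[t + r' mod k = p] (mod k)"
        unfolding cong_int_iff by (simp add: cong_def mod_simps add.commute)
      then show thesis using that[of "r' mod k"] k by simp
    qed
    define i where "i = Suc r"
    have i: "i \<in> {1..k}" "[t + (i - 1) = p] (mod k)" using r by (auto simp: i_def)
    obtain q where q: "\<forall>m. w (t + (i - 1) + m * k) = w (q + m)"
      using hole_value[OF i(2)] by blast
    obtain q' where q': "\<forall>m\<in>{1..M i}. w (q + (m - 1)) = w (q' + (\<pi> i m - 1))"
      using \<pi>[OF i(1)] unfolding word_sym_def by blast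
    have \<sigma>i: "\<sigma> i \<in> {1..k}" using \<sigma> i by blast
    obtain s where s: "[s + (\<sigma> i - 1) = p] (mod k)"
        "\<forall>m<M i. w (s + (\<sigma> i - 1) + m * k) = w (q' + m)"
      using window_with_hole[OF \<sigma>i] by blast
    show ?thesis
    proof (intro exI[of _ s] ballI)
      fix j assume j: "j \<in> {1..n}"
      \<comment> \<open>The representative in \<open>{1..k}\<close> of the residue of
        \<open>j\<close>; a plain \<open>mod\<close> would give 0 instead of
        \<open>k\<close>.\<close>
      define h where "h = Suc ((j - 1) mod k)"
      have h: "h \<in> {1..k}" using k by (auto simp: h_def Suc_le_eq)
      have "[Suc ((j - 1) mod k) = Suc (j - 1)] (mod k)"
        by (simp add: cong_def mod_simps)
      then have "[h = j] (mod k)" using j by (simp add: h_def)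
      then have "j \<in> residue_block k n h"
        using j by (simp add: residue_block_def cong_sym)
      then obtain m where m: "m \<in> {1..M h}" "j = h + (m - 1) * k"
        using blocks[OF h] by blast
      have \<sigma>h: "\<sigma> h \<in> {1..k}" using \<sigma> h by blast
      have gj: "g j - 1 = (\<sigma> h - 1) + (\<pi> h m - 1) * k"
        using g[OF h m(1)] m(2) \<sigma>h by simp
      have j1: "j - 1 = (h - 1) + (m - 1) * k" using m(2) h by simp
      show "w (t + (j - 1)) = w (s + (g j - 1))"
      proof (cases "h = i")
        case True
        have "\<pi> i m \<in> {1..M i}"
          using \<pi>[OF i(1)] m(1) True permutes_in_image unfolding word_sym_def by metis
        then have "\<pi> i m - 1 < M i" by auto
        then show ?thesis
          using q q' s(2) m(1) True unfolding gj j1 by (simp add: add.assoc)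
      next
        \<comment> \<open>Off the holes it suffices to compare residues: on both sides the distance
          to the hole class is \<open>h - i\<close>.\<close>
        case False
        have t: "[int t = int p - int i + 1] (mod int k)"
        proof -
          have "[int (t + (i - 1)) - int (i - 1) = int p - int (i - 1)] (mod int k)"
            using i(2) by (intro cong_diff cong_refl) (simp only: cong_int_iff)
          then show ?thesis using i(1) by (simp add: of_nat_diff algebra_simps)
        qed
        have s: "[int s = int p - int (\<sigma> i) + 1] (mod int k)"
        proof -
          have "[int (s + (\<sigma> i - 1)) - int (\<sigma> i - 1) = int p - int (\<sigma> i - 1)] (mod int k)"
            using s(1) by (intro cong_diff cong_refl) (simp only: cong_int_iff)
          then show ?thesis using \<sigma>i by (simp add: of_nat_diff algebra_simps)
        qed
        have sig: "[int (\<sigma> x) = int x + int c] (mod int k)" if "x \<in> {1..k}" for x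
          using \<sigma>[OF that] by (metis cong_int_iff of_nat_add)
        have "[int t + int h - 1 = (int p - int i + 1) + int h - 1] (mod int k)"
          by (intro cong_diff cong_add t cong_refl)
        then have th: "[int (t + (h - 1)) = int p + (int h - int i)] (mod int k)"
          using h by (simp add: of_nat_diff algebra_simps)
        have "[int s + int (\<sigma> h) - 1 = (int p - int (\<sigma> i) + 1) + int (\<sigma> h) - 1] (mod int k)"
          by (intro cong_diff cong_add s cong_refl)
        moreover have "[(int p - int (\<sigma> i) + 1) + int (\<sigma> h) - 1 =
            (int p - (int i + int c) + 1) + (int h + int c) - 1] (mod int k)"
          by (intro cong_diff cong_add sig h i cong_refl)
        ultimately have "[int s + int (\<sigma> h) - 1 =
            (int p - (int i + int c) + 1) + (int h + int c) - 1] (mod int k)"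
          by (rule cong_trans)
        then have "[int (s + (\<sigma> h - 1)) = int p + (int h - int i)] (mod int k)"
          using \<sigma>h by (simp add: of_nat_diff algebra_simps)
        then have "[int (t + (h - 1)) = int (s + (\<sigma> h - 1))] (mod int k)"
          using th by (metis cong_sym cong_trans)
        then have eq: "(t + (h - 1)) mod k = (s + (\<sigma> h - 1)) mod k"
          by (simp only: cong_int_iff) (simp add: cong_def)
        have "(t + (h - 1)) mod k \<noteq> p"
        proof
          assume "(t + (h - 1)) mod k = p"
          then have "[int p + (int h - int i) = int p + 0] (mod int k)"
            using th by (metis add_0_right hole_residue cong_sym cong_trans)
          then have "int k dvd int h - int i"
            by (simp only: cong_add_lcancel cong_0_iff)
          moreover have "\<bar>int h - int i\<bar> < int k" using h i(1) by auto
          ultimately have "int h - int i = 0" by (rule dvd_abs_less_imp_zero)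
          then show False using False by simp
        qed
        moreover have "(t + (j - 1)) mod k = (t + (h - 1)) mod k"
          "(s + (g j - 1)) mod k = (s + (\<sigma> h - 1)) mod k"
          unfolding gj j1 by (simp_all flip: add.assoc)
        ultimately show ?thesis using eq by (subst eq_iff) simp_all
      qed
    qed
  qed
  then show ?thesis using gp unfolding word_sym_def by blast
qed

lemma residue_block_shift:
  assumes "g permutes {1..n}" "\<forall>j\<in>{1..n}. [g j = j + c] (mod k)" "[i' = i + c] (mod k)"
  shows "g ` residue_block k n i \<subseteq> residue_block k n i'"
proof
  fix y assume "y \<in> g ` residue_block k n i"
  then obtain j where j: "j \<in> {1..n}" "[j = i] (mod k)" "y = g j"
    by (auto simp: residue_block_def)
  have "[y = j + c] (mod k)" using assms(2) j by blast
  moreover have "[j + c = i + c] (mod k)" using j(2) by (intro cong_add cong_refl)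
  ultimately have "[y = i'] (mod k)" using assms(3) by (metis cong_sym cong_trans)
  moreover have "y \<in> {1..n}" using j permutes_in_image[OF assms(1)] by blast
  ultimately show "y \<in> residue_block k n i'" by (simp add: residue_block_def)
qed

section \<open>The two descriptions of the group\<close>

text \<open>A nonzero shift would inject a block of size \<open>a + 1\<close> into one of size
  \<open>a\<close>.\<close>

lemma unequal_blocks_no_shift:
  assumes gp: "g permutes {1..n}" and c: "c < k" "\<forall>j\<in>{1..n}. [g j = j + c] (mod k)"
    and n: "n = a * k + b" "b < k" "b \<noteq> 0"
  shows "c = 0"
proof (rule ccontr)
  assume "c \<noteq> 0"
  \<comment> \<open>The largest index of a long block for which \<open>i + c\<close> does not wrap
    around; block \<open>i + c\<close> is then short.\<close>
  define i where "i = min b (k - c)"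
  have i: "1 \<le> i" "i \<le> b" "b < i + c" "i + c \<le> k"
    using \<open>c \<noteq> 0\<close> c(1) n by (auto simp: i_def)
  have "card (residue_block k n i) \<le> card (residue_block k n (i + c))"
    using residue_block_shift[OF gp c(2), of "i + c" i] permutes_inj_on[OF gp]
    by (intro card_inj_on_le[of g]) (auto simp: residue_block_def)
  then show False
    using card_residue_block[OF n(1,2), of i] card_residue_block[OF n(1,2), of "i + c"] i by simp
qed

lemma symmetry_group_unequal_blocks:
  assumes n: "n = a * k + b" "b < k" "b \<noteq> 0"
  shows "symmetry_group w n = block_product k n (symmetry_group w)"
proof (intro equalityI subsetI)
  let ?M = "\<lambda>i. card (residue_block k n i)"
  have blocks: "residue_block k n i = (\<lambda>m. i + (m - 1) * k) ` {1..?M i}" if "i \<in> {1..k}" for i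
    using residue_block_eq[OF n(1,2)] card_residue_block[OF n(1,2)] that by simp
  {
    fix g assume "g \<in> symmetry_group w n"
    then have g: "word_sym n g" "g permutes {1..n}"
      by (simp_all add: symmetry_group_iff word_sym_def)
    obtain c where c: "c < k" "\<forall>j\<in>{1..n}. [g j = j + c] (mod k)"
      using ex_word_sym_shift[OF g(1)] n by auto
    have "c = 0" using unequal_blocks_no_shift[OF g(2) c n] .
    have "\<forall>i\<in>{1..k}. \<exists>\<pi>. word_sym (?M i) \<pi> \<and>
        (\<forall>m\<in>{1..?M i}. g (i + (m - 1) * k) = i + (\<pi> m - 1) * k)"
      using word_sym_restrict[OF g(1) _ _ blocks blocks]
        residue_block_shift[OF g(2) c(2)] \<open>c = 0\<close> by simp
    then obtain \<pi> where "\<forall>i\<in>{1..k}. word_sym (?M i) (\<pi> i) \<and>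
        (\<forall>m\<in>{1..?M i}. g (i + (m - 1) * k) = i + (\<pi> i m - 1) * k)"
      by metis
    then show "g \<in> block_product k n (symmetry_group w)"
      using g(2) unfolding block_product_def symmetry_group_iff by blast
  next
    fix g assume "g \<in> block_product k n (symmetry_group w)"
    then obtain \<pi> where "g permutes {1..n}" "\<forall>i\<in>{1..k}. word_sym (?M i) (\<pi> i)"
        "\<forall>i\<in>{1..k}. \<forall>m\<in>{1..?M i}. g (i + (m - 1) * k) = i + (\<pi> i m - 1) * k"
      unfolding block_product_def symmetry_group_iff by blast
    then have "word_sym n g"
      using blocks by (intro word_sym_assemble[of g n ?M "\<lambda>i. i" 0 \<pi>]) auto
    then show "g \<in> symmetry_group w n" by (simp add: symmetry_group_iff)
  }
qed

lemma symmetry_group_equal_blocks: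
  assumes "1 \<le> a"
  shows "symmetry_group w (a * k) = block_semidirect k a (symmetry_group w)"
proof (intro equalityI subsetI)
  let ?n = "a * k"
  have blocks: "residue_block k ?n i = (\<lambda>m. i + (m - 1) * k) ` {1..a}" if "i \<in> {1..k}" for i
    using residue_block_eq[of ?n a k 0 i] k that by simp
  define \<sigma> where "\<sigma> c i = Suc ((i - 1 + c) mod k)" for c i
  have \<sigma>: "\<sigma> c i \<in> {1..k} \<and> [\<sigma> c i = i + c] (mod k)" if "i \<in> {1..k}" for c i
  proof -
    have "[Suc ((i - 1 + c) mod k) = Suc (i - 1 + c)] (mod k)"
      by (simp add: cong_def mod_simps)
    then show ?thesis using that k by (auto simp: \<sigma>_def Suc_le_eq)
  qed
  have \<sigma>_unique: "i' = \<sigma> c i" if "i \<in> {1..k}" "i' \<in> {1..k}" "[i' = i + c] (mod k)" for c i i'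
  proof -
    have "[i' = \<sigma> c i] (mod k)" using \<sigma>[OF that(1)] that(3) by (metis cong_sym cong_trans)
    then have "[int i' = int (\<sigma> c i)] (mod int k)" by (simp only: cong_int_iff)
    then have "int k dvd int i' - int (\<sigma> c i)" by (simp add: cong_iff_dvd_diff)
    moreover have "\<bar>int i' - int (\<sigma> c i)\<bar> < int k" using \<sigma>[OF that(1), of c] that(2) by auto
    ultimately have "int i' - int (\<sigma> c i) = 0" by (rule dvd_abs_less_imp_zero)
    then show ?thesis by simp
  qed
  {
    fix g assume "g \<in> symmetry_group w ?n"
    then have g: "word_sym ?n g" "g permutes {1..?n}"
      by (simp_all add: symmetry_group_iff word_sym_def)
    obtain c where c: "c < k" "\<forall>j\<in>{1..?n}. [g j = j + c] (mod k)"
      using ex_word_sym_shift[OF g(1)] assms k by auto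
    have "\<forall>i\<in>{1..k}. \<exists>\<pi>. word_sym a \<pi> \<and>
        (\<forall>m\<in>{1..a}. g (i + (m - 1) * k) = \<sigma> c i + (\<pi> m - 1) * k)"
      using word_sym_restrict[OF g(1) _ _ blocks blocks]
        residue_block_shift[OF g(2) c(2)] \<sigma> by simp
    then obtain \<pi> where "\<forall>i\<in>{1..k}. word_sym a (\<pi> i) \<and>
        (\<forall>m\<in>{1..a}. g (i + (m - 1) * k) = \<sigma> c i + (\<pi> i m - 1) * k)"
      by metis
    then show "g \<in> block_semidirect k a (symmetry_group w)"
      using g(2) c(1) \<sigma>_unique unfolding block_semidirect_def symmetry_group_iff
      by (auto intro!: bexI[of _ c] exI[of _ \<pi>])
  next
    fix g assume "g \<in> block_semidirect k a (symmetry_group w)"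
    then obtain c \<pi> where "g permutes {1..?n}" "\<forall>i\<in>{1..k}. word_sym a (\<pi> i)"
        "\<forall>i\<in>{1..k}. \<forall>i'\<in>{1..k}. [i' = i + c] (mod k) \<longrightarrow>
           (\<forall>m\<in>{1..a}. g (i + (m - 1) * k) = i' + (\<pi> i m - 1) * k)"
      unfolding block_semidirect_def symmetry_group_iff by blast
    then have "word_sym ?n g"
      using blocks \<sigma> by (intro word_sym_assemble[of g ?n "\<lambda>_. a" "\<sigma> c" c \<pi>]) blast+
    then show "g \<in> symmetry_group w ?n" by (simp add: symmetry_group_iff)
  }
qed

end

section \<open>From the pattern to a one-hole word\<close>

text \<open>This count is the index at which \<open>toeplitz_fill\<close> reads for the hole
  \<open>p + k * q\<close>; it yields the assumption \<open>hole\<close>.\<close>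

lemma card_residue_below:
  fixes p k q :: nat
  assumes "p < k"
  shows "card {j. j < p + k * q \<and> j mod k = p} = q"
proof -
  have "{j. j < p + k * q \<and> j mod k = p} = (\<lambda>i. p + k * i) ` {..<q}"
  proof (intro equalityI subsetI)
    fix j assume "j \<in> {j. j < p + k * q \<and> j mod k = p}"
    then have j: "j < p + k * q" "j = p + k * (j div k)"
      by (auto simp: mod_mult_div_eq[symmetric])
    then have "k * (j div k) < k * q" by linarith
    then show "j \<in> (\<lambda>i. p + k * i) ` {..<q}" using j(2) by auto
  qed (use assms in auto)
  then show ?thesis
    using assms by (simp add: card_image inj_on_def)
qed

text \<open>The recursion passes to the limit because a letter of the filled word depends on at most
  one letter of the filling; at a late stage both are final.\<close>

lemma toeplitz_word_fixed_point:
  assumes "toeplitz_pattern \<Sigma> u"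
  shows "toeplitz_fill u (Some \<circ> toeplitz_word u) i = Some (toeplitz_word u i)"
proof -
  let ?h = "card {j. j < i \<and> omega_power u j = None}"
  have lim: "\<forall>\<^sub>F m in sequentially. toeplitz_approx u m n = Some (toeplitz_word u n)" for n
    using toeplitz_word_limit(2)[OF assms] by blast
  have "\<forall>\<^sub>F m in sequentially. toeplitz_approx u (Suc m) i = Some (toeplitz_word u i) \<and>
      toeplitz_approx u m ?h = Some (toeplitz_word u ?h)"
    using lim[of i] lim[of ?h]
    by (intro eventually_conj) (rule iffD2[OF eventually_sequentially_Suc], blast+)
  then obtain m where "toeplitz_approx u (Suc m) i = Some (toeplitz_word u i)"
      "toeplitz_approx u m ?h = Some (toeplitz_word u ?h)"
    using eventually_happens'[OF sequentially_bot] by blast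
  then show ?thesis by (simp add: toeplitz_fill_def split: if_splits)
qed

lemma toeplitz_one_hole_word:
  assumes u: "toeplitz_pattern \<Sigma> u" and c: "count_list u None = 1" and k: "4 \<le> length u"
    and d: "distinct (filter (\<lambda>s. s \<noteq> None) u)"
  shows "\<exists>p. one_hole_word (toeplitz_word u) (length u) p"
proof -
  have "None \<in> set u" using c by (metis count_list_0_iff zero_neq_one)
  then obtain xs ys where xy: "u = xs @ None # ys" by (meson split_list)
  then have no: "None \<notin> set xs" "None \<notin> set ys"
    using c by (auto simp: count_list_0_iff)
  define p where "p = length xs"
  have p: "p < length u" by (simp add: p_def xy)
  have "filter (\<lambda>s. s \<noteq> None) xs = xs" "filter (\<lambda>s. s \<noteq> None) ys = ys"
    using no by (metis (mono_tags, lifting) filter_True)+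
  \<comment> \<open>The filter drops only the single \<open>None\<close>, so the hole has a unique
    index in \<open>u\<close>.\<close>
  then have "distinct u" using d no by (auto simp: xy)
  then have nth: "u ! i = u ! j \<longleftrightarrow> i = j" if "i < length u" "j < length u" for i j
    using that by (simp add: nth_eq_iff_index_eq)
  have up: "u ! p = None" by (simp add: xy p_def)
  have None_iff: "omega_power u i = None \<longleftrightarrow> i mod length u = p" for i
    using nth[of "i mod length u" p] p k up unfolding omega_power_def
    by (metis gr_zeroI mod_less_divisor not_less_zero)
  have "p \<noteq> 0"
  proof
    assume "p = 0"
    then show False using u up by (auto simp: toeplitz_pattern_def hd_conv_nth)
  qed
  have fix_pt: "toeplitz_fill u (Some \<circ> toeplitz_word u) i = Some (toeplitz_word u i)" for i
    using toeplitz_word_fixed_point[OF u] .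
  have letter: "u ! (i mod length u) = Some (toeplitz_word u i)" if "i mod length u \<noteq> p" for i
    using fix_pt[of i] that by (simp add: toeplitz_fill_def None_iff) (simp add: omega_power_def)
  show ?thesis
  proof (intro exI[of _ p] one_hole_word.intro)
    show "toeplitz_word u (p + length u * j) = toeplitz_word u j" for j
      using fix_pt[of "p + length u * j"] p
      by (simp add: toeplitz_fill_def None_iff card_residue_below)
    show "toeplitz_word u i = toeplitz_word u j \<longleftrightarrow> i mod length u = j mod length u"
      if "i mod length u \<noteq> p" "j mod length u \<noteq> p" for i j
      using letter[OF that(1)] letter[OF that(2)] nth[of "i mod length u" "j mod length u"] p
      by (metis gr_zeroI mod_less_divisor not_less_zero option.inject)
  qed (use k p \<open>p \<noteq> 0\<close> in auto)
qed

theorem theorem6: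
  fixes \<Sigma> :: "'a set" and u :: "'a option list" and w :: "nat \<Rightarrow> 'a" and k n a b :: nat
  assumes "finite \<Sigma>"
    and "toeplitz_pattern \<Sigma> u"
    and "count_list u None = 1"
    and "length u = k" and "k \<ge> 4"
    and "distinct (filter (\<lambda>s. s \<noteq> None) u)"
    and "w = toeplitz_word u"
    and "n = a * k + b" and "n \<ge> 1" and "b \<le> k - 1"
  shows "symmetry_group w n =
    (if b \<noteq> 0 then block_product k n (symmetry_group w)
     else block_semidirect k a (symmetry_group w))"
proof -
  obtain p where "one_hole_word w k p"
    using toeplitz_one_hole_word[OF assms(2,3) _ assms(6)] assms(4,5,7) by auto
  then interpret one_hole_word w k p .
  show ?thesis
  proof (cases "b = 0")
    case True
    \<comment> \<open>Position 1, from which the shift is read off, thus exists.\<close>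
    then have "1 \<le> a" using assms(8,9) by (cases a) auto
    then show ?thesis using symmetry_group_equal_blocks True assms(8) by simp
  next
    case False
    then show ?thesis using symmetry_group_unequal_blocks[OF assms(8)] assms(5,10) by simp
  qed
qed

end
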